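(* For every regular space $X$ we have $\mathrm{d}(X)<2^{\mathrm{pd}(X)}$.
   Context: Regular spaces are assumed to be Hausdorff ($T_3$). For a topological space $X$ with topology $\tau_X$, a neighborhood assignment on $X$ is a map $U:X\to\tau_X$ with $x\in U(x)$ for all $x\in X$. A set $A\subseteq X$ pins down $U$ if $A\cap U(x)\neq\emptyset$ for all $x\in X$. The pinning down number $\mathrm{pd}(X)$ is the smallest cardinal $\kappa$ such that every neighborhood assignment on $X$ can be pinned down by a subset of $X$ of size $\kappa$. $\mathrm{d}(X)$ is the density of $X$ (the smallest cardinality of a dense subset). *)

theory Defs
  imports "HOL-Analysis.Analysis"
begin

unbundle cardinal_syntax

text \<open>
  Cardinals are represented by cardinal orders (\<^const>\<open>Card_order\<close>). Taking them on the type
  of the points loses no generality, since neither \<open>d(X)\<close> nor \<open>pd(X)\<close> exceeds the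
  cardinality of \<open>X\<close>. The least cardinal of a nonempty set of cardinals exists and is
  determined up to \<open>=o\<close>.
\<close>

definition least_cardinal :: "'a rel set \<Rightarrow> 'a rel"
  where "least_cardinal R = (SOME r. r \<in> R \<and> (\<forall>r'\<in>R. r \<le>o r'))"

lemma least_cardinal:
  assumes "R \<noteq> {}" and "\<And>r. r \<in> R \<Longrightarrow> Card_order r"
  shows "least_cardinal R \<in> R" and "\<And>r. r \<in> R \<Longrightarrow> least_cardinal R \<le>o r"
proof -
  have "\<exists>r. r \<in> R \<and> (\<forall>r'\<in>R. r \<le>o r')"
    using exists_minim_Card_order[of R] assms by blast
  then have "least_cardinal R \<in> R \<and> (\<forall>r'\<in>R. least_cardinal R \<le>o r')"
    unfolding least_cardinal_def by (rule someI_ex)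
  then show "least_cardinal R \<in> R" and "\<And>r. r \<in> R \<Longrightarrow> least_cardinal R \<le>o r"
    by auto
qed

definition neighborhood_assignment :: "'a topology \<Rightarrow> ('a \<Rightarrow> 'a set) \<Rightarrow> bool"
  where "neighborhood_assignment X U \<longleftrightarrow> (\<forall>x\<in>topspace X. openin X (U x) \<and> x \<in> U x)"

definition pins_down :: "'a topology \<Rightarrow> 'a set \<Rightarrow> ('a \<Rightarrow> 'a set) \<Rightarrow> bool"
  where "pins_down X A U \<longleftrightarrow> A \<subseteq> topspace X \<and> (\<forall>x\<in>topspace X. A \<inter> U x \<noteq> {})"

definition pd_cardinals :: "'a topology \<Rightarrow> 'a rel set"
  where "pd_cardinals X =
    {\<kappa>. Card_order \<kappa> \<and>
      (\<forall>U. neighborhood_assignment X U \<longrightarrow> (\<exists>A. pins_down X A U \<and> |A| =o \<kappa>))}"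

definition pinning_down_number :: "'a topology \<Rightarrow> 'a rel"
  where "pinning_down_number X = least_cardinal (pd_cardinals X)"

definition dense_cardinals :: "'a topology \<Rightarrow> 'a rel set"
  where "dense_cardinals X = {|D| | D. D \<subseteq> topspace X \<and> X closure_of D = topspace X}"

definition density_number :: "'a topology \<Rightarrow> 'a rel"
  where "density_number X = least_cardinal (dense_cardinals X)"

lemma pinning_down_number:
  shows "pinning_down_number X \<in> pd_cardinals X"
    and "\<And>\<kappa>. \<kappa> \<in> pd_cardinals X \<Longrightarrow> pinning_down_number X \<le>o \<kappa>"
proof -
  have "pins_down X (topspace X) U" if "neighborhood_assignment X U" for U
    using that by (auto simp: pins_down_def neighborhood_assignment_def)
  then have "|topspace X| \<in> pd_cardinals X"
    unfolding pd_cardinals_def using card_of_Card_order card_of_refl by blast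
  then have ne: "pd_cardinals X \<noteq> {}" by blast
  have co: "\<And>\<kappa>. \<kappa> \<in> pd_cardinals X \<Longrightarrow> Card_order \<kappa>"
    by (simp add: pd_cardinals_def)
  show "pinning_down_number X \<in> pd_cardinals X"
    and "\<And>\<kappa>. \<kappa> \<in> pd_cardinals X \<Longrightarrow> pinning_down_number X \<le>o \<kappa>"
    unfolding pinning_down_number_def using least_cardinal[OF ne co] by auto
qed

lemma density_number:
  shows "density_number X \<in> dense_cardinals X"
    and "\<And>\<kappa>. \<kappa> \<in> dense_cardinals X \<Longrightarrow> density_number X \<le>o \<kappa>"
proof -
  have "|topspace X| \<in> dense_cardinals X"
    by (force simp: dense_cardinals_def)
  then have ne: "dense_cardinals X \<noteq> {}" by blast
  have co: "\<And>\<kappa>. \<kappa> \<in> dense_cardinals X \<Longrightarrow> Card_order \<kappa>"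
    by (auto simp: dense_cardinals_def intro: card_of_Card_order)
  show "density_number X \<in> dense_cardinals X"
    and "\<And>\<kappa>. \<kappa> \<in> dense_cardinals X \<Longrightarrow> density_number X \<le>o \<kappa>"
    unfolding density_number_def using least_cardinal[OF ne co] by auto
qed

end

theory Submission
  imports Defs
begin

text \<open>
  Let \<open>\<kappa> = pd(X)\<close> be infinite (for finite \<open>\<kappa>\<close> the space has at most \<open>\<kappa>\<close> points). A family of at most \<open>\<mu>\<close>
  open sets, each of size at least \<open>\<mu>\<close>, has an injective choice function and can therefore be pinned
  down by \<open>\<kappa>\<close> points. Call an open set small if it has fewer than \<open>2\<^sup>\<kappa>\<close> points. If an open set \<open>W\<close>
  without small open subsets has \<open>2\<^sup>\<kappa>\<close> points, pinning down the complements in \<open>W\<close> of the closures of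
  its subsets of size \<open>\<kappa>\<close> gives \<open>d(W) \<le> \<kappa>\<close>. If all open subsets of \<open>W\<close> have more than \<open>2\<^sup>\<kappa>\<close> points,
  regularity yields \<open>\<pi>(W) \<le> 2\<^sup>\<kappa>\<close>, and pinning down a \<open>\<pi>\<close>-base gives \<open>d(W) \<le> \<kappa>\<close> again. So a
  maximal disjoint family of open sets of density below \<open>2\<^sup>\<kappa>\<close> has a dense union. It has at most \<open>\<kappa>\<close>
  members, whence \<open>d(X) < 2\<^sup>\<kappa>\<close> since the cofinality of \<open>2\<^sup>\<kappa>\<close> exceeds \<open>\<kappa>\<close>.
\<close>

section \<open>Cardinal arithmetic\<close>

lemma card_of_not_ordLeq: "\<not> |A| \<le>o |B| \<longleftrightarrow> |B| <o |A|"
  by (rule not_ordLeq_iff_ordLess[OF card_of_Well_order card_of_Well_order])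

lemma transfinite_choice:
  assumes "Well_order r"
  shows "\<exists>f. \<forall>i. f i = H i (f ` underS r i)"
proof -
  have wo: "wo_rel r" using assms by (simp add: wo_rel_def)
  let ?F = "\<lambda>f i. H i (f ` underS r i)"
  have "wo_rel.adm_wo r ?F"
    unfolding wo_rel.adm_wo_def[OF wo] by (metis (no_types, lifting) image_cong)
  then have "wo_rel.worec r ?F = ?F (wo_rel.worec r ?F)"
    by (rule wo_rel.worec_fixpoint[OF wo])
  then show ?thesis by (intro exI[of _ "wo_rel.worec r ?F"] allI) (rule fun_cong)
qed

text \<open>As \<open>|I|\<close> is an initial ordinal, each \<open>i\<close> has fewer than
  \<open>|I|\<close> predecessors, so the values already taken cannot exhaust
  \<open>S i\<close>.\<close>

lemma injective_choice:
  assumes "\<And>i. i \<in> I \<Longrightarrow> |I| \<le>o |S i|"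
  obtains f where "inj_on f I" "\<And>i. i \<in> I \<Longrightarrow> f i \<in> S i"
proof -
  have wo: "Well_order |I|" by (rule card_of_Well_order)
  obtain f where f: "\<forall>i. f i = (SOME x. x \<in> S i \<and> x \<notin> f ` underS |I| i)"
    using transfinite_choice[OF wo, of "\<lambda>i T. SOME x. x \<in> S i \<and> x \<notin> T"] by (rule exE)
  have *: "f i \<in> S i \<and> f i \<notin> f ` underS |I| i" if i: "i \<in> I" for i
  proof -
    have "|f ` underS |I| i| \<le>o |underS |I| i|" by (rule card_of_image)
    also have "|underS |I| i| <o |I|"
      using i by (intro card_of_underS card_of_Card_order) (simp add: Field_card_of)
    also have "|I| \<le>o |S i|" using assms i .
    finally have "\<not> S i \<subseteq> f ` underS |I| i"
      by (metis card_of_mono1 not_ordLess_ordLeq)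
    then have "\<exists>x. x \<in> S i \<and> x \<notin> f ` underS |I| i" by auto
    then show ?thesis unfolding f[rule_format, of i] by (rule someI_ex)
  qed
  have "inj_on f I"
  proof (rule inj_onI)
    fix i j assume ij: "i \<in> I" "j \<in> I" "f i = f j"
    have "i = j \<or> i \<in> underS |I| j \<or> j \<in> underS |I| i"
      using ij wo_rel.TOTALS[of "|I|"] wo by (auto simp: wo_rel_def underS_def Field_card_of)
    then show "i = j" using * ij by (metis imageI)
  qed
  with * show thesis by (intro that) auto
qed

lemma card_of_Pow_mono:
  assumes "|A| \<le>o |B|"
  shows "|Pow A| \<le>o |Pow B|"
proof -
  obtain f where f: "inj_on f A" "f ` A \<subseteq> B" using iffD2[OF card_of_ordLeq assms] by blast
  then show ?thesis
    by (intro card_of_ordLeqI[of "image f"]) (auto simp: inj_on_image_eq_iff intro!: inj_onI)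
qed

lemma card_of_Pow_Times:
  assumes "infinite K" "|I| \<le>o |K|"
  shows "|Pow (I \<times> K)| \<le>o |Pow K|"
  using assms by (intro card_of_Pow_mono card_of_Sigma_ordLeq_infinite)
    (auto intro: ordIso_imp_ordLeq card_of_refl)

text \<open>Koenig's theorem: the cofinality of \<open>2\<^sup>\<kappa>\<close> exceeds \<open>\<kappa>\<close>.\<close>
lemma card_of_UNION_ordLess_Pow:
  assumes K: "infinite K" "|I| \<le>o |K|" and S: "\<And>i. i \<in> I \<Longrightarrow> |S i| <o |Pow K|"
  shows "|\<Union>i\<in>I. S i| <o |Pow K|"
proof (rule ccontr)
  assume "\<not> ?thesis"
  then have "|Pow K| \<le>o |\<Union>i\<in>I. S i|" using card_of_not_ordLeq by blast
  from ordLeq_transitive[OF card_of_Pow_Times[OF K] this]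
  have le: "|Pow (I \<times> K)| \<le>o |\<Union>i\<in>I. S i|" .
  obtain f where f: "f ` (\<Union>i\<in>I. S i) = Pow (I \<times> K)"
    using iffD2[OF card_of_ordLeq2[OF Pow_not_empty] le] by (rule exE)
  \<comment> \<open>Diagonal argument: \<open>G i\<close> differs from every section over
    \<open>i\<close> of a relation coded in \<open>S i\<close>, so \<open>Sigma I G\<close> has no
    code in any \<open>S i\<close>.\<close>
  have "\<exists>G. G \<subseteq> K \<and> G \<notin> (\<lambda>s. f s `` {i}) ` S i" if "i \<in> I" for i
  proof -
    have "|(\<lambda>s. f s `` {i}) ` S i| <o |Pow K|"
      by (rule ordLeq_ordLess_trans[OF card_of_image S[OF that]])
    then have "\<not> Pow K \<subseteq> (\<lambda>s. f s `` {i}) ` S i"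
      by (metis card_of_mono1 not_ordLess_ordLeq)
    then show ?thesis by blast
  qed
  then obtain G where G: "\<And>i. i \<in> I \<Longrightarrow> G i \<subseteq> K \<and> G i \<notin> (\<lambda>s. f s `` {i}) ` S i"
    by metis
  have "Sigma I G \<in> Pow (I \<times> K)" using G by auto
  then have "Sigma I G \<in> f ` (\<Union>i\<in>I. S i)" by (simp only: f)
  then obtain i s where s: "i \<in> I" "s \<in> S i" "f s = Sigma I G" by auto
  then have "f s `` {i} = G i" by auto
  with s G show False by blast
qed

text \<open>A nonempty \<open>A\<close> of size at most \<open>|K|\<close> is the range of some
  \<open>f\<close> on \<open>K\<close>. With the points of \<open>Y\<close> coded as subsets of
  \<open>K\<close>, such an \<open>f\<close> becomes a relation on \<open>K\<close> whose sections
  are the codes of the points of \<open>A\<close>.\<close>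

lemma card_of_small_subsets:
  assumes K: "infinite K" and Y: "|Y| \<le>o |Pow K|"
  shows "|{A. A \<subseteq> Y \<and> A \<noteq> {} \<and> |A| \<le>o |K|}| \<le>o |Pow K|"
proof -
  obtain h where h: "inj_on h Y" "h ` Y \<subseteq> Pow K" using iffD2[OF card_of_ordLeq Y] by blast
  have "{A. A \<subseteq> Y \<and> A \<noteq> {} \<and> |A| \<le>o |K|}
      \<subseteq> (\<lambda>R. {y \<in> Y. \<exists>k\<in>K. h y = R `` {k}}) ` Pow (K \<times> K)"
  proof
    fix A assume "A \<in> {A. A \<subseteq> Y \<and> A \<noteq> {} \<and> |A| \<le>o |K|}"
    then have A: "A \<subseteq> Y" "A \<noteq> {}" "|A| \<le>o |K|" by auto
    then obtain f where f: "f ` K = A" using iffD2[OF card_of_ordLeq2[of A K]] by blast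
    let ?R = "SIGMA k:K. h (f k)"
    have "A = {y \<in> Y. \<exists>k\<in>K. h y = ?R `` {k}}"
    proof -
      have "?R `` {k} = h (f k)" if "k \<in> K" for k using that by auto
      then have "{y \<in> Y. \<exists>k\<in>K. h y = ?R `` {k}} = {y \<in> Y. \<exists>k\<in>K. h y = h (f k)}" by auto
      also have "\<dots> = {y \<in> Y. \<exists>k\<in>K. y = f k}"
        using f A(1)
        by (intro Collect_cong conj_cong bex_cong refl) (auto simp: inj_on_eq_iff[OF h(1)])
      finally show ?thesis using f A(1) by auto
    qed
    moreover have "?R \<in> Pow (K \<times> K)" using h(2) f A(1) by fastforce
    ultimately show "A \<in> (\<lambda>R. {y \<in> Y. \<exists>k\<in>K. h y = R `` {k}}) ` Pow (K \<times> K)"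
      by (rule image_eqI)
  qed
  then have "|{A. A \<subseteq> Y \<and> A \<noteq> {} \<and> |A| \<le>o |K|}| \<le>o |Pow (K \<times> K)|"
    by (rule surj_imp_ordLeq)
  from ordLeq_transitive[OF this card_of_Pow_Times[OF K ordIso_imp_ordLeq[OF card_of_refl]]]
  show ?thesis .
qed

section \<open>Closing a set under a unary and a binary operation\<close>

inductive_set op_closure :: "('b \<Rightarrow> 'b) \<Rightarrow> ('b \<Rightarrow> 'b \<Rightarrow> 'b) \<Rightarrow> 'b set \<Rightarrow> 'b set"
  for h g S where
  base: "x \<in> S \<Longrightarrow> x \<in> op_closure h g S"
| unary: "x \<in> op_closure h g S \<Longrightarrow> h x \<in> op_closure h g S"
| binary: "x \<in> op_closure h g S \<Longrightarrow> y \<in> op_closure h g S \<Longrightarrow> g x y \<in> op_closure h g S"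

lemma op_closure_mono:
  assumes "S \<subseteq> T"
  shows "op_closure h g S \<subseteq> op_closure h g T"
proof
  fix x assume "x \<in> op_closure h g S"
  then show "x \<in> op_closure h g T"
    by induction (use assms in \<open>auto intro: op_closure.intros\<close>)
qed

lemma card_of_op_closure:
  assumes L: "infinite L" and S: "|S| \<le>o |L|"
  shows "|op_closure h g S| \<le>o |L|"
proof -
  \<comment> \<open>The closure is exhausted by countably many stages, none of which exceeds the
    infinite cardinal \<open>|L|\<close>.\<close>
  let ?F = "\<lambda>B. B \<union> (h ` B \<union> (\<lambda>(x, y). g x y) ` (B \<times> B))"
  let ?B = "\<lambda>n. (?F ^^ n) S"
  have mono: "?B m \<subseteq> ?B n" if "m \<le> n" for m n
    using that by (rule lift_Suc_mono_le[rotated]) auto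
  have "x \<in> (\<Union>n. ?B n)" if "x \<in> op_closure h g S" for x
    using that
  proof induction
    case (base x)
    then have "x \<in> ?B 0" by simp
    then show ?case by blast
  next
    case (unary x)
    then obtain n where "x \<in> ?B n" by blast
    then have "h x \<in> ?B (Suc n)" by auto
    then show ?case by blast
  next
    case (binary x y)
    then obtain m n where "x \<in> ?B m" "y \<in> ?B n" by blast
    then have "x \<in> ?B (max m n)" "y \<in> ?B (max m n)"
      using mono[of m "max m n"] mono[of n "max m n"] by auto
    then have "g x y \<in> ?B (Suc (max m n))" by auto
    then show ?case by blast
  qed
  then have "op_closure h g S \<subseteq> (\<Union>n. ?B n)" by blast
  moreover have "|?B n| \<le>o |L|" for n
  proof (induction n)
    case (Suc n)
    have "|h ` ?B n| \<le>o |L|" by (rule ordLeq_transitive[OF card_of_image Suc])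
    moreover have "|(\<lambda>(x, y). g x y) ` (?B n \<times> ?B n)| \<le>o |L|"
      by (rule ordLeq_transitive[OF card_of_image card_of_Sigma_ordLeq_infinite])
        (use L Suc in auto)
    ultimately show ?case
      unfolding funpow.simps o_apply using Suc L
      by (intro card_of_Un_ordLeq_infinite_Field card_of_Card_order) (simp_all add: Field_card_of)
  qed (simp add: S)
  then have "|\<Union>n. ?B n| \<le>o |L|"
    using L by (intro card_of_UNION_ordLeq_infinite) (auto simp: infinite_iff_card_of_nat)
  ultimately show ?thesis using ordLeq_transitive[OF card_of_mono1] by blast
qed


section \<open>Pinning down families of open sets\<close>

text \<open>This is pd(X) \<le> \<open>|K|\<close>. An upper bound on the size of \<open>A\<close>
  is all that the arguments below ask for.\<close>

locale pinned_space =
  fixes X :: "'a topology" and K :: "'a set"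
  assumes pinned: "neighborhood_assignment X U \<Longrightarrow> \<exists>A. pins_down X A U \<and> |A| \<le>o |K|"
begin

text \<open>An assignment gives each point only one set, so a family can be encoded in it once its
  members have distinct representatives. All other points get the whole space.\<close>

lemma pin_transversal:
  assumes "\<And>B. B \<in> \<B> \<Longrightarrow> openin X B \<and> x B \<in> B" and "inj_on x \<B>"
  shows "\<exists>A. A \<subseteq> topspace X \<and> |A| \<le>o |K| \<and> (\<forall>B\<in>\<B>. A \<inter> B \<noteq> {})"
proof -
  let ?U = "\<lambda>y. if y \<in> x ` \<B> then inv_into \<B> x y else topspace X"
  have U: "?U (x B) = B" if "B \<in> \<B>" for B using that assms(2) by simp
  have "neighborhood_assignment X ?U"
    unfolding neighborhood_assignment_def using assms by auto
  then obtain A where A: "pins_down X A ?U" "|A| \<le>o |K|" using pinned by blast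
  have "A \<inter> B \<noteq> {}" if B: "B \<in> \<B>" for B
  proof -
    have "x B \<in> topspace X" using B assms(1) openin_subset by blast
    then have "A \<inter> ?U (x B) \<noteq> {}" using A(1) unfolding pins_down_def by blast
    then show ?thesis using U[OF B] by simp
  qed
  moreover have "A \<subseteq> topspace X" using A(1) by (simp add: pins_down_def)
  ultimately show ?thesis using A(2) by blast
qed

lemma pin_family:
  assumes "\<And>B. B \<in> \<B> \<Longrightarrow> openin X B \<and> |\<B>| \<le>o |B|"
  shows "\<exists>A. A \<subseteq> topspace X \<and> |A| \<le>o |K| \<and> (\<forall>B\<in>\<B>. A \<inter> B \<noteq> {})"
proof -
  obtain x where "inj_on x \<B>" "\<And>B. B \<in> \<B> \<Longrightarrow> x B \<in> B"
    using injective_choice[of \<B> "\<lambda>B. B"] assms by metis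
  with assms show ?thesis by (intro pin_transversal[of \<B> x]) auto
qed

text \<open>The cellularity of X is at most \<open>|K|\<close>: a set that meets every
  \<open>V i\<close> contains a different point for each \<open>i\<close>.\<close>

lemma card_of_disjoint_open_family:
  assumes "\<And>i. i \<in> I \<Longrightarrow> openin X (V i) \<and> V i \<noteq> {}" and disj: "disjoint_family_on V I"
  shows "|I| \<le>o |K|"
proof -
  let ?x = "\<lambda>B. SOME y. y \<in> B"
  have x: "openin X B \<and> ?x B \<in> B" if "B \<in> V ` I" for B
    using that assms(1) by (auto simp: some_in_eq)
  have "inj_on ?x (V ` I)"
  proof (rule inj_onI)
    fix B C assume BC: "B \<in> V ` I" "C \<in> V ` I" "?x B = ?x C"
    then have "B \<inter> C \<noteq> {}" using x[OF BC(1)] x[OF BC(2)] by auto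
    moreover obtain i j where "i \<in> I" "j \<in> I" "B = V i" "C = V j" using BC(1,2) by auto
    ultimately show "B = C" using disjoint_family_onD[OF disj, of i j] by auto
  qed
  with x obtain A where A: "A \<subseteq> topspace X" "|A| \<le>o |K|"
    "\<forall>B\<in>V ` I. A \<inter> B \<noteq> {}"
    using pin_transversal[of "V ` I" ?x] by metis
  then have "\<forall>i\<in>I. \<exists>a. a \<in> A \<inter> V i" by blast
  then obtain a where a: "\<And>i. i \<in> I \<Longrightarrow> a i \<in> A \<inter> V i" by metis
  have "inj_on a I"
  proof (rule inj_onI)
    fix i j assume ij: "i \<in> I" "j \<in> I" "a i = a j"
    then have "V i \<inter> V j \<noteq> {}" using a[OF ij(1)] a[OF ij(2)] by auto
    then show "i = j" using disjoint_family_onD[OF disj, of i j] ij(1,2) by auto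
  qed
  then have "|I| \<le>o |A|" using a by (intro card_of_ordLeqI[of a]) auto
  then show ?thesis using A(2) by (rule ordLeq_transitive)
qed

section \<open>Dense subsets of size at most \<open>|K|\<close> in open sets\<close>

lemma small_dense_if_card_le_Pow:
  assumes K: "infinite K" and W: "openin X W" "|W| \<le>o |Pow K|"
    and big: "\<And>V. openin X V \<Longrightarrow> V \<noteq> {} \<Longrightarrow> V \<subseteq> W \<Longrightarrow> |Pow K| \<le>o |V|"
  shows "\<exists>D\<subseteq>W. |D| \<le>o |K| \<and> W \<subseteq> X closure_of D"
proof (rule ccontr)
  assume nd: "\<not> ?thesis"
  define \<S> where "\<S> = {A. A \<subseteq> W \<and> A \<noteq> {} \<and> |A| \<le>o |K|}"
  define \<B> where "\<B> = (\<lambda>A. W - X closure_of A) ` \<S>"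
  have "|\<B>| \<le>o |Pow K|"
    unfolding \<B>_def \<S>_def
    by (rule ordLeq_transitive[OF card_of_image card_of_small_subsets[OF K W(2)]])
  moreover have op: "openin X B \<and> B \<noteq> {} \<and> B \<subseteq> W" if "B \<in> \<B>" for B
    using that nd W(1) by (auto simp: \<B>_def \<S>_def)
  ultimately have "openin X B \<and> |\<B>| \<le>o |B|" if "B \<in> \<B>" for B
    using that op[OF that] big[of B] ordLeq_transitive by metis
  then obtain A where A: "A \<subseteq> topspace X" "|A| \<le>o |K|" "\<forall>B\<in>\<B>. A \<inter> B \<noteq> {}"
    using pin_family[of \<B>] by metis
  \<comment> \<open>Singletons belong to \<open>\<S>\<close>, which forces \<open>A\<close> to meet
    \<open>W\<close>. Then \<open>A \<inter> W\<close> itself is in \<open>\<S>\<close>, and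
    \<open>A\<close> would have to meet the complement of its closure in \<open>W\<close>.\<close>
  have "W \<noteq> {}" using nd by (metis card_of_empty empty_subsetI)
  then obtain w where w: "w \<in> W" by blast
  then have "{w} \<in> \<S>" using K by (simp add: \<S>_def card_of_singl_ordLeq infinite_imp_nonempty)
  then have "W - X closure_of {w} \<in> \<B>" by (simp add: \<B>_def)
  then have "A \<inter> (W - X closure_of {w}) \<noteq> {}" using A(3) by blast
  then have "A \<inter> W \<noteq> {}" by blast
  then have "A \<inter> W \<in> \<S>"
    using ordLeq_transitive[OF card_of_mono1[OF Int_lower1] A(2)] by (simp add: \<S>_def)
  then have "W - X closure_of (A \<inter> W) \<in> \<B>" by (simp add: \<B>_def)
  then have "A \<inter> (W - X closure_of (A \<inter> W)) \<noteq> {}" using A(3) by blast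
  moreover have "A \<inter> W \<subseteq> X closure_of (A \<inter> W)" using A(1) by (intro closure_of_subset) blast
  ultimately show False by blast
qed

text \<open>A chain of length \<open>(2\<^sup>\<kappa>)\<^sup>+\<close> of families of open sets, each of whose steps adds a set that
  contains no member of the previous families, would yield a family \<open>\<B>\<close> pinned down by some \<open>A\<close>
  of size \<open>\<kappa>\<close>. The closure properties of \<open>\<B>\<close> make a member \<open>V\<close> whose trace on \<open>A\<close> is that of
  \<open>h U\<close> a subset of \<open>U\<close>, and there are only \<open>2\<^sup>\<kappa>\<close> traces.\<close>
lemma small_pi_base:
  assumes reg: "regular_space X" and K: "infinite K" and W: "openin X W"
    and big: "\<And>V. openin X V \<Longrightarrow> V \<noteq> {} \<Longrightarrow> V \<subseteq> W \<Longrightarrow> |Pow K| <o |V|"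
  defines "\<O> \<equiv> {V. openin X V \<and> V \<noteq> {} \<and> V \<subseteq> W}"
  shows "\<exists>\<P>\<subseteq>\<O>. |\<P>| \<le>o |Pow K| \<and> (\<forall>V\<in>\<O>. \<exists>P\<in>\<P>. P \<subseteq> V)"
proof (rule ccontr)
  assume "\<not> ?thesis"
  then have ex: "\<exists>V\<in>\<O>. \<forall>P\<in>\<P>. \<not> P \<subseteq> V" if "|\<P>| \<le>o |Pow K|" "\<P> \<subseteq> \<O>" for \<P>
    using that by blast
  have "\<exists>H. H \<in> \<O> \<and> X closure_of H \<subseteq> V" if "V \<in> \<O>" for V
  proof -
    have "V \<noteq> {}" using that by (simp add: \<O>_def)
    then obtain x where "x \<in> V" by blast
    moreover have "openin X V" "V \<subseteq> W" using that by (simp_all add: \<O>_def)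
    moreover have "neighbourhood_base_of (closedin X) X"
      using reg by (simp add: neighbourhood_base_of_closedin)
    ultimately obtain H C where H: "openin X H" "closedin X C" "x \<in> H" "H \<subseteq> C" "C \<subseteq> V"
      unfolding neighbourhood_base_of by meson
    moreover have "X closure_of H \<subseteq> C" using H(4,2) by (rule closure_of_minimal)
    ultimately show ?thesis using \<open>V \<subseteq> W\<close> by (intro exI[of _ H]) (auto simp: \<O>_def)
  qed
  then obtain h where h: "\<And>V. V \<in> \<O> \<Longrightarrow> h V \<in> \<O> \<and> X closure_of (h V) \<subseteq> V" by metis
  \<comment> \<open>The default value \<open>V\<close> keeps \<open>g\<close> inside
    \<open>\<O>\<close> when the difference is empty.\<close>
  define g where "g V H = (if V - X closure_of H = {} then V else V - X closure_of H)" for V H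
  have g: "g V H \<in> \<O>" if "V \<in> \<O>" for V H
    using that by (auto simp: g_def \<O>_def)
  let ?c = "op_closure h g"
  have c: "?c S \<subseteq> \<O>" if "S \<subseteq> \<O>" for S
  proof
    fix V assume "V \<in> ?c S"
    then show "V \<in> \<O>" by induction (use that h g in auto)
  qed
  let ?r = "cardSuc |Pow K|"
  have infP: "infinite (Pow K)" using K by simp
  have Cr: "Card_order ?r" by (intro cardSuc_Card_order card_of_Card_order)
  then have Wr: "Well_order ?r" by (rule card_order_on_well_order_on)
  have infr: "infinite (Field ?r)" using infP by (simp add: card_of_cardSuc_finite)
  have wr: "wo_rel ?r" using Wr by (simp add: wo_rel_def)
  obtain f where f: "\<forall>i. f i = (SOME V. V \<in> \<O> \<and> (\<forall>P\<in>?c (f ` underS ?r i). \<not> P \<subseteq> V))"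
    using transfinite_choice[OF Wr, of "\<lambda>i S. SOME V. V \<in> \<O> \<and> (\<forall>P\<in>?c S. \<not> P \<subseteq> V)"] by (rule exE)
  define \<A> where "\<A> i = ?c (f ` underS ?r i)" for i
  have card\<A>: "|\<A> i| \<le>o |Pow K|" if "i \<in> Field ?r" for i
  proof -
    have "|underS ?r i| <o ?r" using Cr that by (rule card_of_underS)
    then have "|underS ?r i| \<le>o |Pow K|" by (simp add: cardSuc_ordLeq_ordLess card_of_Card_order)
    then have "|f ` underS ?r i| \<le>o |Pow K|" by (rule ordLeq_transitive[OF card_of_image])
    then show ?thesis unfolding \<A>_def by (rule card_of_op_closure[OF infP])
  qed
  have f\<O>: "f i \<in> \<O> \<and> (\<forall>P\<in>\<A> i. \<not> P \<subseteq> f i)" if "i \<in> Field ?r" for i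
    using that
  proof (induction i rule: wo_rel.well_order_induct[OF wr])
    case (1 i)
    have "j \<in> Field ?r \<and> j \<noteq> i \<and> (j, i) \<in> ?r" if "j \<in> underS ?r i" for j
      using that by (auto simp: underS_def Field_def)
    then have "f ` underS ?r i \<subseteq> \<O>" using 1 by blast
    then have "\<A> i \<subseteq> \<O>" unfolding \<A>_def by (rule c)
    then have "\<exists>V. V \<in> \<O> \<and> (\<forall>P\<in>?c (f ` underS ?r i). \<not> P \<subseteq> V)"
      using ex[OF card\<A>[OF 1(2)]] unfolding \<A>_def by blast
    then show ?case unfolding \<A>_def f[rule_format, of i] by (rule someI_ex)
  qed
  have \<A>\<O>: "\<A> i \<subseteq> \<O>" if "i \<in> Field ?r" for i
    unfolding \<A>_def using f\<O> by (intro c) (auto simp: underS_def Field_def)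
  have chain: "\<A> i \<subseteq> \<A> j" if "(i, j) \<in> ?r" for i j
    unfolding \<A>_def
    by (intro op_closure_mono image_mono underS_incr that wo_rel.TRANS[OF wr] wo_rel.ANTISYM[OF wr])
  define \<B> where "\<B> = (\<Union>i\<in>Field ?r. \<A> i)"
  have hB: "h V \<in> \<B>" if "V \<in> \<B>" for V
    using that by (auto simp: \<B>_def \<A>_def intro: op_closure.unary)
  \<comment> \<open>The families \<open>\<A> i\<close> increase, so both arguments lie in a common
    one.\<close>
  have gB: "g V H \<in> \<B>" if VH: "V \<in> \<B>" "H \<in> \<B>" for V H
  proof -
    obtain i j where ij: "i \<in> Field ?r" "j \<in> Field ?r" "V \<in> \<A> i" "H \<in> \<A> j"
      using VH by (auto simp: \<B>_def)
    then have "(i, j) \<in> ?r \<or> (j, i) \<in> ?r" using wo_rel.TOTALS[OF wr] by blast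
    then obtain k where "k \<in> Field ?r" "V \<in> \<A> k" "H \<in> \<A> k"
      using ij chain by blast
    then show ?thesis by (auto simp: \<B>_def \<A>_def intro: op_closure.binary)
  qed
  \<comment> \<open>\<open>\<A> i\<close> is generated by the values strictly before
    \<open>i\<close>, so \<open>f i\<close> enters only at a later index. One exists because an
    infinite cardinal is a limit.\<close>
  have fB: "f i \<in> \<B>" if i: "i \<in> Field ?r" for i
  proof -
    obtain j where "j \<in> Field ?r" "i \<noteq> j" "(i, j) \<in> ?r"
      using infinite_Card_order_limit[OF Cr infr i] by blast
    then have "f i \<in> \<A> j" "j \<in> Field ?r"
      by (auto simp: \<A>_def underS_def intro: op_closure.base)
    then show ?thesis by (auto simp: \<B>_def)
  qed
  have B\<O>: "\<B> \<subseteq> \<O>" unfolding \<B>_def using \<A>\<O> by (rule UN_least)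
  have Fr: "|Field ?r| =o ?r" using Cr by (rule card_of_Field_ordIso)
  have "|\<B>| \<le>o |Field ?r|"
    unfolding \<B>_def
  proof (rule card_of_UNION_ordLeq_infinite[OF infr])
    have "|Pow K| \<le>o |Field ?r|"
      by (rule ordLess_imp_ordLeq[OF ordLess_ordIso_trans[OF
            cardSuc_greater[OF card_of_Card_order] ordIso_symmetric[OF Fr]]])
    then show "\<forall>i\<in>Field ?r. |\<A> i| \<le>o |Field ?r|"
      using ordLeq_transitive[OF card\<A>] by blast
  qed (rule ordIso_imp_ordLeq[OF card_of_refl])
  then have cB: "|\<B>| \<le>o ?r" using Fr by (rule ordLeq_ordIso_trans)
  \<comment> \<open>A member with more than \<open>|Pow K|\<close> points has at least
    \<open>?r\<close> points, and \<open>?r\<close> bounds \<open>|\<B>|\<close>.\<close>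
  have "openin X V \<and> |\<B>| \<le>o |V|" if "V \<in> \<B>" for V
  proof -
    have V: "V \<in> \<O>" using that B\<O> by blast
    then have "?r \<le>o |V|" using big[of V] by (auto simp: \<O>_def intro: cardSuc_least card_of_Card_order)
    then show ?thesis using V ordLeq_transitive[OF cB] by (auto simp: \<O>_def)
  qed
  then obtain A where A: "A \<subseteq> topspace X" "|A| \<le>o |K|" "\<forall>B\<in>\<B>. A \<inter> B \<noteq> {}"
    using pin_family[of \<B>] by metis
  let ?tr = "\<lambda>V. A \<inter> V"
  \<comment> \<open>One representative is taken for each trace on \<open>A\<close>. By regularity of
    the successor cardinal, these at most \<open>|Pow K|\<close> sets already lie in a single
    \<open>\<A> i\<close>.\<close>
  define \<T> where "\<T> = inv_into \<B> ?tr ` ?tr ` \<B>"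
  have "|?tr ` \<B>| \<le>o |Pow A|" by (rule card_of_mono1) auto
  also have "|Pow A| \<le>o |Pow K|" by (rule card_of_Pow_mono[OF A(2)])
  finally have "|\<T>| \<le>o |Pow K|"
    unfolding \<T>_def by (rule ordLeq_transitive[OF card_of_image])
  moreover have "\<T> \<subseteq> \<B>" by (auto simp: \<T>_def intro: inv_into_into)
  moreover have "relChain ?r \<A>" using chain by (simp add: relChain_def)
  ultimately obtain i where i: "i \<in> Field ?r" "\<T> \<subseteq> \<A> i"
    using cardSuc_UNION[of "|Pow K|" \<A> \<T>] infP card_of_Card_order[of "Pow K"]
    unfolding \<B>_def Field_card_of by blast
  have U: "f i \<in> \<B>" "h (f i) \<in> \<B>" using fB hB i(1) by auto
  define V where "V = inv_into \<B> ?tr (?tr (h (f i)))"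
  have V: "V \<in> \<T>" "V \<in> \<B>" "A \<inter> V = A \<inter> h (f i)"
    using U(2) by (auto simp: V_def \<T>_def inv_into_into f_inv_into_f[of _ ?tr \<B>])
  \<comment> \<open>By its choice \<open>f i\<close> contains no member of \<open>\<A> i\<close>.
    Hence \<open>V\<close> leaves the closure of \<open>h (f i)\<close>, and the difference is a
    member of \<open>\<B>\<close>. Yet it misses \<open>A\<close>, since \<open>V\<close> and
    \<open>h (f i)\<close> have the same trace.\<close>
  have "\<not> V \<subseteq> f i" using f\<O> i V(1) by blast
  then have "V - X closure_of (h (f i)) \<noteq> {}" using h[of "f i"] U(1) B\<O> by blast
  then have "V - X closure_of (h (f i)) \<in> \<B>"
    using gB[OF V(2) U(2)] by (simp add: g_def)
  then have "A \<inter> (V - X closure_of (h (f i))) \<noteq> {}" using A(3) by blast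
  moreover have "h (f i) \<subseteq> X closure_of (h (f i))"
    using U(2) B\<O> by (intro closure_of_subset) (auto simp: \<O>_def dest: openin_subset)
  ultimately show False using V(3) by blast
qed

lemma small_dense_if_card_gt_Pow:
  assumes reg: "regular_space X" and K: "infinite K" and W: "openin X W"
    and big: "\<And>V. openin X V \<Longrightarrow> V \<noteq> {} \<Longrightarrow> V \<subseteq> W \<Longrightarrow> |Pow K| <o |V|"
  shows "\<exists>D\<subseteq>W. |D| \<le>o |K| \<and> W \<subseteq> X closure_of D"
proof -
  let ?\<O> = "{V. openin X V \<and> V \<noteq> {} \<and> V \<subseteq> W}"
  obtain \<P> where P: "|\<P>| \<le>o |Pow K|" "\<P> \<subseteq> ?\<O>" "\<forall>V\<in>?\<O>. \<exists>P\<in>\<P>. P \<subseteq> V"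
    using small_pi_base[OF reg K W big] by auto
  have "openin X P \<and> |\<P>| \<le>o |P|" if "P \<in> \<P>" for P
    using P(2) that ordLeq_transitive[OF P(1) ordLess_imp_ordLeq[OF big[of P]]] by blast
  then obtain A where A: "A \<subseteq> topspace X" "|A| \<le>o |K|" "\<forall>P\<in>\<P>. A \<inter> P \<noteq> {}"
    using pin_family[of \<P>] by metis
  \<comment> \<open>\<open>\<P>\<close> is a \<pi>-base of \<open>W\<close>, so each neighborhood of
    \<open>x\<close> contains a member of \<open>\<P>\<close> lying in \<open>W\<close>, and
    \<open>A\<close> meets it.\<close>
  have "x \<in> X closure_of (A \<inter> W)" if x: "x \<in> W" for x
    unfolding in_closure_of
  proof safe
    show "x \<in> topspace X" using x W openin_subset by blast
    fix T assume "x \<in> T" "openin X T"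
    then obtain P where "P \<in> \<P>" "P \<subseteq> T \<inter> W"
      using P(3) x W by (auto dest!: bspec[of _ _ "T \<inter> W"])
    then show "\<exists>y. y \<in> A \<inter> W \<and> y \<in> T" using A(3) by blast
  qed
  moreover have "|A \<inter> W| \<le>o |K|"
    by (rule ordLeq_transitive[OF card_of_mono1[OF Int_lower1] A(2)])
  ultimately show ?thesis by (intro exI[of _ "A \<inter> W"]) auto
qed

section \<open>Assembling a dense subset of the whole space\<close>

lemma dense_subset_ordLess_Pow:
  assumes reg: "regular_space X" and K: "infinite K"
  obtains D where "D \<subseteq> topspace X" "X closure_of D = topspace X" "|D| <o |Pow K|"
proof -
  define good where
    "good W \<longleftrightarrow> openin X W \<and> W \<noteq> {} \<and> (\<exists>D\<subseteq>W. |D| <o |Pow K| \<and> W \<subseteq> X closure_of D)" for W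
  have ex: "\<exists>W\<subseteq>V. good W" if V: "openin X V" "V \<noteq> {}" for V
  proof (cases "\<exists>W\<subseteq>V. openin X W \<and> W \<noteq> {} \<and> |W| <o |Pow K|")
    case True
    then obtain W where W: "W \<subseteq> V" "openin X W" "W \<noteq> {}" "|W| <o |Pow K|" by blast
    then have "W \<subseteq> X closure_of W" using closure_of_subset openin_subset by metis
    with W show ?thesis unfolding good_def by blast
  next
    case False
    then have ge: "|Pow K| \<le>o |W|" if "openin X W" "W \<noteq> {}" "W \<subseteq> V" for W
      using that card_of_not_ordLeq by blast
    \<comment> \<open>No nonempty open subset of \<open>V\<close> is small now, so either one has
      exactly \<open>|Pow K|\<close> points or all have more.\<close>
    have "\<exists>W\<subseteq>V. openin X W \<and> W \<noteq> {} \<and> (\<exists>D\<subseteq>W. |D| \<le>o |K| \<and> W \<subseteq> X closure_of D)"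
    proof (cases "\<exists>W\<subseteq>V. openin X W \<and> W \<noteq> {} \<and> |W| \<le>o |Pow K|")
      case True
      then obtain W where W: "W \<subseteq> V" "openin X W" "W \<noteq> {}" "|W| \<le>o |Pow K|" by blast
      then have "\<exists>D\<subseteq>W. |D| \<le>o |K| \<and> W \<subseteq> X closure_of D"
        using ge by (intro small_dense_if_card_le_Pow[OF K]) auto
      with W show ?thesis by blast
    next
      case False
      then have "|Pow K| <o |W|" if "openin X W" "W \<noteq> {}" "W \<subseteq> V" for W
        using that card_of_not_ordLeq by blast
      then have "\<exists>D\<subseteq>V. |D| \<le>o |K| \<and> V \<subseteq> X closure_of D"
        by (rule small_dense_if_card_gt_Pow[OF reg K V(1)])
      with V show ?thesis by blast
    qed
    then show ?thesis
      unfolding good_def using ordLeq_ordLess_trans[OF _ card_of_Pow] by blast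
  qed
  let ?F = "{\<W>. Ball \<W> good \<and> disjoint \<W>}"
  have "\<exists>\<M>\<in>?F. \<forall>\<W>\<in>?F. \<M> \<subseteq> \<W> \<longrightarrow> \<W> = \<M>"
  proof (rule subset_Zorn')
    fix C assume "subset.chain ?F C"
    then have C: "\<And>\<W>. \<W> \<in> C \<Longrightarrow> Ball \<W> good \<and> disjoint \<W>"
      "\<And>\<V> \<W>. \<V> \<in> C \<Longrightarrow> \<W> \<in> C \<Longrightarrow> \<V> \<subseteq> \<W> \<or> \<W> \<subseteq> \<V>"
      by (auto simp: subset_chain_def)
    have "disjoint (\<Union>C)"
      unfolding pairwise_def
    proof (intro ballI impI)
      fix P Q assume "P \<in> \<Union>C" "Q \<in> \<Union>C" "P \<noteq> Q"
      then obtain \<W> where "\<W> \<in> C" "P \<in> \<W>" "Q \<in> \<W>" using C(2) by blast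
      then show "disjnt P Q" using C(1) \<open>P \<noteq> Q\<close> by (auto simp: pairwise_def)
    qed
    then show "\<Union>C \<in> ?F" using C(1) by auto
  qed
  then obtain \<M> where M: "\<M> \<in> ?F" and max: "\<forall>\<W>\<in>?F. \<M> \<subseteq> \<W> \<longrightarrow> \<W> = \<M>"
    by (rule bexE)
  have "disjoint_family_on (\<lambda>W. W) \<M>"
    using M by (auto simp: disjoint_family_on_def pairwise_def disjnt_def)
  then have cM: "|\<M>| \<le>o |K|"
    using M by (intro card_of_disjoint_open_family[of \<M> "\<lambda>W. W"]) (auto simp: good_def)
  obtain d where d: "\<And>W. W \<in> \<M> \<Longrightarrow> d W \<subseteq> W \<and> |d W| <o |Pow K| \<and> W \<subseteq> X closure_of d W"
    using M unfolding good_def by simp metis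
  let ?D = "\<Union>W\<in>\<M>. d W"
  have "x \<in> X closure_of ?D" if x: "x \<in> topspace X" for x
    unfolding in_closure_of
  proof safe
    fix T assume T: "x \<in> T" "openin X T"
    then obtain W where W: "W \<subseteq> T" "good W" using ex by blast
    \<comment> \<open>Otherwise the good set \<open>W\<close> could be added to the maximal family
      \<open>\<M>\<close>.\<close>
    have "\<exists>M\<in>\<M>. M \<inter> W \<noteq> {}"
    proof (rule ccontr)
      assume no: "\<not> ?thesis"
      then have "disjoint (insert W \<M>)"
        using M by (auto simp: pairwise_insert disjnt_def)
      then have "insert W \<M> = \<M>" using M W by (intro max[rule_format]) auto
      then have "W \<in> \<M>" by blast
      then show False using no W by (auto simp: good_def)
    qed
    then obtain M y where y: "M \<in> \<M>" "y \<in> M" "y \<in> W" by blast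
    then have "y \<in> X closure_of d M" using d by blast
    moreover have "openin X W" using W by (simp add: good_def)
    ultimately obtain z where "z \<in> d M" "z \<in> W" using y(3) by (auto simp: in_closure_of)
    then show "\<exists>y. y \<in> ?D \<and> y \<in> T" using y(1) W by blast
  qed (use x in auto)
  then have "X closure_of ?D = topspace X"
    by (intro subset_antisym closure_of_subset_topspace subsetI)
  moreover have "?D \<subseteq> topspace X"
  proof (rule UN_least)
    fix W assume W: "W \<in> \<M>"
    then have "W \<subseteq> topspace X" using M by (auto simp: good_def openin_subset)
    then show "d W \<subseteq> topspace X" using d[OF W] by blast
  qed
  moreover have "|?D| <o |Pow K|"
    using d by (intro card_of_UNION_ordLess_Pow[OF K cM]) auto
  ultimately show thesis using that by metis
qed

text \<open>In a Hausdorff space, \<open>Suc (card K)\<close> points would have pairwise disjoint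
  neighborhoods, which exceeds the cellularity bound.\<close>

lemma card_of_topspace_finite:
  assumes H: "Hausdorff_space X" and K: "finite K"
  shows "|topspace X| \<le>o |K|"
proof (rule ccontr)
  assume big: "\<not> ?thesis"
  have "\<exists>F\<subseteq>topspace X. finite F \<and> card F = Suc (card K)"
  proof (cases "finite (topspace X)")
    case True
    then have "card K < card (topspace X)"
      using card_le_inj[OF True K] card_of_ordLeq[of "topspace X" K] big by fastforce
    then show ?thesis using obtain_subset_with_card_n[of "Suc (card K)" "topspace X"]
      by (metis Suc_leI)
  next
    case False
    then show ?thesis using infinite_arbitrarily_large by blast
  qed
  then obtain F where F: "F \<subseteq> topspace X" "finite F" "card F = Suc (card K)" by blast
  have "\<exists>p. openin X (fst p) \<and> openin X (snd p) \<and> x \<in> fst p \<and> y \<in> snd p \<and> disjnt (fst p) (snd p)"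
    if "x \<in> F" "y \<in> F" "x \<noteq> y" for x y
    using H F(1) that unfolding Hausdorff_space_def by (metis fst_conv snd_conv subsetD)
  then obtain p where p: "\<And>x y. x \<in> F \<Longrightarrow> y \<in> F \<Longrightarrow> x \<noteq> y \<Longrightarrow>
      openin X (fst (p x y)) \<and> openin X (snd (p x y)) \<and> x \<in> fst (p x y) \<and> y \<in> snd (p x y)
      \<and> disjnt (fst (p x y)) (snd (p x y))"
    by metis
  \<comment> \<open>The separating pair \<open>p x y\<close> need not be \<open>p y x\<close>
    swapped. Using \<open>x\<close> in both argument positions makes \<open>N x\<close> and
    \<open>N y\<close> lie in the two halves of one pair.\<close>
  define N where "N x = topspace X \<inter> (\<Inter>y\<in>F - {x}. fst (p x y) \<inter> snd (p y x))" for x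
  have "openin X (N x) \<and> N x \<noteq> {}" if "x \<in> F" for x
  proof
    show "openin X (N x)"
      unfolding N_def using F(2) p that by (intro openin_Int_Inter) auto
    have "x \<in> N x" using p that F(1) by (auto simp: N_def)
    then show "N x \<noteq> {}" by blast
  qed
  moreover have "disjoint_family_on N F"
    unfolding disjoint_family_on_def
  proof (intro ballI impI)
    fix x y assume xy: "x \<in> F" "y \<in> F" "x \<noteq> y"
    then have "N x \<subseteq> fst (p x y)" "N y \<subseteq> snd (p x y)" by (auto simp: N_def)
    then show "N x \<inter> N y = {}" using p[OF xy] by (auto simp: disjnt_def)
  qed
  ultimately have "|F| \<le>o |K|" by (rule card_of_disjoint_open_family)
  then obtain f where "inj_on f F" "f ` F \<subseteq> K" using iffD2[OF card_of_ordLeq] by blast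
  then show False using card_inj_on_le[of f F K] F K by simp
qed

end

theorem theorem4p8:
  fixes X :: "'a topology"
  assumes "regular_space X" and "Hausdorff_space X"
  shows "density_number X <o ctwo ^c pinning_down_number X"
proof -
  let ?\<kappa> = "pinning_down_number X"
  define K where "K = Field ?\<kappa>"
  have co: "Card_order ?\<kappa>" using pinning_down_number(1)[of X] by (simp add: pd_cardinals_def)
  then have K: "|K| =o ?\<kappa>" unfolding K_def by (rule card_of_Field_ordIso)
  interpret pinned_space X K
  proof
    fix U assume "neighborhood_assignment X U"
    then obtain A where "pins_down X A U" "|A| =o ?\<kappa>"
      using pinning_down_number(1)[of X] by (auto simp: pd_cardinals_def)
    then show "\<exists>A. pins_down X A U \<and> |A| \<le>o |K|"
      using ordIso_imp_ordLeq[OF ordIso_transitive[OF _ ordIso_symmetric[OF K]]] by blast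
  qed
  have "\<exists>D\<subseteq>topspace X. X closure_of D = topspace X \<and> |D| <o |Pow K|"
  proof (cases "finite K")
    case True
    \<comment> \<open>Here the whole space serves as the dense set.\<close>
    then have "|topspace X| <o |Pow K|"
      by (intro ordLeq_ordLess_trans[OF card_of_topspace_finite[OF assms(2)] card_of_Pow])
    then show ?thesis by (intro exI[of _ "topspace X"]) auto
  next
    case False
    then show ?thesis using dense_subset_ordLess_Pow[OF assms(1)] by metis
  qed
  then obtain D where "D \<subseteq> topspace X" "X closure_of D = topspace X" "|D| <o |Pow K|" by blast
  then have "density_number X <o |Pow K|"
    by (intro ordLeq_ordLess_trans[OF density_number(2)[of "|D|" X]]) (auto simp: dense_cardinals_def)
  also have "|Pow K| =o ctwo ^c ?\<kappa>"
    unfolding cexp_def ctwo_def K_def by (simp add: card_of_Pow_Func Field_card_of)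
  finally show ?thesis .
qed

end
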